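(* Let $q$ be a prime power, let $n>k\ge 2$ be integers, let $G\in\mathbb{F}_q^{k\times n}$ be a matrix of rank $k$ with no zero column, and let $\mathcal{R}=(\mathcal{R}_1,\ldots,\mathcal{R}_k)$ be a $G$-system. Then the following hold. 1. $\Lambda^{\mathbb{Q}}(\mathcal{R})=\Lambda(\mathcal{R})\cap\mathbb{Q}^k$. 2. $\Lambda(\mathcal{R})=\overline{\Lambda^{\mathbb{Q}}(\mathcal{R})}$, where the latter is the closure of $\Lambda^{\mathbb{Q}}(\mathcal{R})$ with respect to the Euclidean topology in $\mathbb{R}^k$.
   Context: Let $G^\nu$ denote the $\nu$-th column of $G$ and $e_i$ the $i$-th standard basis vector of $\mathbb{F}_q^k$. For $i\in\{1,\ldots,k\}$ let $\mathcal{R}_i^{\mathrm{all}}(G)=\{R\subseteq\{1,\ldots,n\}\mid e_i\in\langle G^\nu\mid\nu\in R\rangle\}$, where $\langle\cdot\rangle$ is the $\mathbb{F}_q$-span. A $G$-system is a $k$-tuple $\mathcal{R}=(\mathcal{R}_1,\ldots,\mathcal{R}_k)$ with $\emptyset\ne\mathcal{R}_i\subseteq\mathcal{R}_i^{\mathrm{all}}(G)$ for all $i$. The service rate region $\Lambda(\mathcal{R})\subseteq\mathbb{R}^k$ (with server capacity $1$) is the set of all $(\lambda_1,\ldots,\lambda_k)\in\mathbb{R}^k$ for which there exist real numbers $\lambda_{i,R}\ge 0$ ($i\in\{1,\ldots,k\}$, $R\in\mathcal{R}_i$) with $\sum_{R\in\mathcal{R}_i}\lambda_{i,R}=\lambda_i$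 for all $i$, and $\sum_{i=1}^k\sum_{R\in\mathcal{R}_i,\,\nu\in R}\lambda_{i,R}\le 1$ for all $\nu\in\{1,\ldots,n\}$. Here $\mathbb{N}$ contains $0$. An $\mathcal{R}$-allocation is a $k$-tuple of functions $\alpha=(\alpha_1,\ldots,\alpha_k)$ with $\alpha_i:\mathcal{R}_i\to\mathbb{N}$. Its service rate is $\lambda(\alpha)=(\lambda_1,\ldots,\lambda_k)\in\mathbb{N}^k$ with $\lambda_i=\sum_{R\in\mathcal{R}_i}\alpha_i(R)$. For $\nu\in\{1,\ldots,n\}$ put $\delta_\nu(\mathcal{R},\alpha)=\sum_{i=1}^k\sum_{R\in\mathcal{R}_i,\,\nu\in R}\alpha_i(R)$. For an integer $s\ge 1$, the one-shot service rate region with capacity $s$ is $$\Lambda_1(\mathcal{R},s)=\{\lambda(\alpha)/s\mid\alpha\text{ an }\mathcal{R}\text{-allocation},\ \delta_\nu(\mathcal{R},\alpha)\le s\text{ for }1\le\nu\le n\}.$$ The rational service rate region is $\Lambda^{\mathbb{Q}}(\mathcal{R})=\bigcup_{s\in\mathbb{Z}_{\ge 1}}\Lambda_1(\mathcal{R},s)$. *)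

theory Defs
  imports "HOL-Analysis.Analysis" "HOL-Number_Theory.Prime_Powers"
begin

text \<open>
  The index sets \<open>{1, \<dots>, k}\<close> and \<open>{1, \<dots>, n}\<close> are the finite types \<open>'k\<close> and \<open>'n\<close>; the field
  with \<open>q\<close> elements is a finite field type \<open>'f\<close>. The dimensions are arbitrary but fixed.
\<close>

definition recovery_sets_all :: "'f::field ^ 'n ^ 'k \<Rightarrow> 'k \<Rightarrow> 'n set set" where
  "recovery_sets_all G i = {S. axis i 1 \<in> vec.span ((\<lambda>\<nu>. column \<nu> G) ` S)}"

definition G_system :: "'f::field ^ 'n ^ 'k \<Rightarrow> ('k \<Rightarrow> 'n set set) \<Rightarrow> bool" where
  "G_system G \<R> \<longleftrightarrow> (\<forall>i. \<R> i \<noteq> {} \<and> \<R> i \<subseteq> recovery_sets_all G i)"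

definition service_rate_region :: "('k::finite \<Rightarrow> 'n::finite set set) \<Rightarrow> (real ^ 'k) set" where
  "service_rate_region \<R> =
    {x. \<exists>l :: 'k \<Rightarrow> 'n set \<Rightarrow> real.
          (\<forall>i. \<forall>S\<in>\<R> i. l i S \<ge> 0) \<and>
          (\<forall>i. (\<Sum>S\<in>\<R> i. l i S) = x $ i) \<and>
          (\<forall>\<nu>. (\<Sum>i\<in>UNIV. \<Sum>S\<in>{S \<in> \<R> i. \<nu> \<in> S}. l i S) \<le> 1)}"

text \<open>
  An allocation is represented by a total function \<open>\<alpha>\<close>; only the values \<open>\<alpha> i S\<close> with \<open>S \<in> \<R> i\<close>
  enter the definitions below.
\<close>

definition service_rate ::
  "('k::finite \<Rightarrow> 'n::finite set set) \<Rightarrow> ('k \<Rightarrow> 'n set \<Rightarrow> nat) \<Rightarrow> nat ^ 'k" where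
  "service_rate \<R> \<alpha> = (\<chi> i. \<Sum>S\<in>\<R> i. \<alpha> i S)"

definition server_load ::
  "('k::finite \<Rightarrow> 'n::finite set set) \<Rightarrow> ('k \<Rightarrow> 'n set \<Rightarrow> nat) \<Rightarrow> 'n \<Rightarrow> nat" where
  "server_load \<R> \<alpha> \<nu> = (\<Sum>i\<in>UNIV. \<Sum>S\<in>{S \<in> \<R> i. \<nu> \<in> S}. \<alpha> i S)"

definition one_shot_region ::
  "('k::finite \<Rightarrow> 'n::finite set set) \<Rightarrow> nat \<Rightarrow> (real ^ 'k) set" where
  "one_shot_region \<R> s =
    {(\<chi> i. real (service_rate \<R> \<alpha> $ i) / real s) | \<alpha>. \<forall>\<nu>. server_load \<R> \<alpha> \<nu> \<le> s}"

definition rational_service_rate_region ::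
  "('k::finite \<Rightarrow> 'n::finite set set) \<Rightarrow> (real ^ 'k) set" where
  "rational_service_rate_region \<R> = (\<Union>s\<in>{1..}. one_shot_region \<R> s)"

end

theory Submission
  imports Defs
begin

text \<open>
  Scaling shows that \<open>\<Lambda>\<^sup>\<rat>(\<R>)\<close> consists exactly of the rates of nonnegative \<^emph>\<open>rational\<close>
  allocations of load at most \<open>1\<close>: a one-shot allocation with capacity \<open>s\<close> is divided by \<open>s\<close>, and
  conversely finitely many rational values have a common denominator. What remains is to compare
  rational with real allocations.

  For the first claim, a real allocation \<open>\<lambda>\<close> with rational rates must be replaced by a rational one
  with the same rates. The conditions on \<open>\<lambda>\<close> are finitely many linear equations and inequalities
  with rational coefficients, so any \<open>\<rat>\<close>-linear map \<open>\<phi> : \<real> \<rightarrow> \<rat>\<close> with \<open>\<phi>(1) = 1\<close> preserves the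
  equations when applied to every \<open>\<lambda>\<^sub>i\<^sub>,\<^sub>R\<close>. It also preserves those inequalities that hold with
  equality, since \<open>\<phi>(0) = 0\<close>, and the strict ones as soon as \<open>\<phi>\<close> moves the finitely many relevant
  numbers by little enough. Such a \<open>\<phi>\<close> exists (\<open>rational_linear_approximation\<close>): the values of
  \<open>\<phi>\<close> on a Hamel basis may be chosen freely, in particular close to the basis elements.

  For the second claim, rounding \<open>m\<lambda>\<^sub>i\<^sub>,\<^sub>R\<close> down to an integer gives one-shot allocations with capacity
  \<open>m\<close> whose rates converge to those of \<open>\<lambda>\<close>, so \<open>\<Lambda>\<^sup>\<rat>(\<R>)\<close> is dense in \<open>\<Lambda>(\<R>)\<close>. On the other hand
  \<open>\<Lambda>(\<R>)\<close> is closed: no recovery set is empty, as \<open>e\<^sub>i \<noteq> 0\<close>, hence every \<open>\<lambda>\<^sub>i\<^sub>,\<^sub>R\<close> is bounded by the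
  load of a server in \<open>R\<close>, and \<open>\<Lambda>(\<R>)\<close> is the linear image of a compact set of allocations.
\<close>

section \<open>Rational-linear maps close to the identity\<close>

interpretation rat_real: vector_space "\<lambda>(q::rat) (x::real). of_rat q * x"
  by unfold_locales (auto simp: algebra_simps of_rat_add of_rat_mult)

interpretation rat_real_pair: vector_space_pair
  "\<lambda>(q::rat) (x::real). of_rat q * x" "\<lambda>(q::rat) (x::real). of_rat q * x"
  by unfold_locales

text \<open>
  Expand the elements of \<open>X\<close> in a Hamel basis that contains \<open>1\<close>, so that \<open>\<phi>(1) = 1\<close> can be
  prescribed along with the other basis values. Only finitely many nonzero coefficients occur, so
  moving each basis element by at most \<open>\<delta>\<close> moves \<open>x \<in> X\<close> by at most \<open>\<delta>\<close> times the sum of the absolute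
  values of all coefficients.
\<close>

lemma rational_linear_approximation:
  fixes X :: "real set"
  assumes fin: "finite X" and eps: "\<epsilon> > 0"
  obtains \<phi> :: "real \<Rightarrow> real"
  where "\<And>x y. \<phi> (x + y) = \<phi> x + \<phi> y" "\<And>r x. \<phi> (of_rat r * x) = of_rat r * \<phi> x"
    "\<phi> 1 = 1" "\<And>x. \<phi> x \<in> \<rat>" "\<And>x. x \<in> X \<Longrightarrow> \<bar>\<phi> x - x\<bar> < \<epsilon>"
proof -
  define B where "B = rat_real.extend_basis {1}"
  have ind1: "rat_real.independent {1}"
    by simp
  have B: "rat_real.independent B" "rat_real.span B = UNIV" "1 \<in> B"
    using rat_real.independent_extend_basis[OF ind1] rat_real.span_extend_basis[OF ind1]
      rat_real.extend_basis_superset[OF ind1]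
    by (auto simp: B_def)
  define c where "c = rat_real.representation B"
  have fin_c: "finite {b. c x b \<noteq> 0}" for x
    unfolding c_def by (rule rat_real.finite_representation)
  have expand: "(\<Sum>b | c x b \<noteq> 0. of_rat (c x b) * b) = x" for x
    unfolding c_def using B by (intro rat_real.sum_nonzero_representation_eq) auto
  define M :: real where "M = (\<Sum>x\<in>X. \<Sum>b | c x b \<noteq> 0. \<bar>of_rat (c x b)\<bar>)"
  have M_nonneg: "M \<ge> 0"
    unfolding M_def by (intro sum_nonneg) auto
  define \<delta> where "\<delta> = \<epsilon> / (M + 1)"
  have delta: "\<delta> > 0"
    using eps M_nonneg by (simp add: \<delta>_def)
  have "\<exists>r\<in>\<rat>. \<bar>r - b\<bar> < \<delta> \<and> (b = 1 \<longrightarrow> r = 1)" for b :: real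
  proof (cases "b = 1")
    case True
    then show ?thesis
      using delta by (intro bexI[of _ 1]) auto
  next
    case False
    obtain r where "r \<in> \<rat>" "b < r" "r < b + \<delta>"
      using Rats_dense_in_real[of b "b + \<delta>"] delta by auto
    then show ?thesis
      using False by (intro bexI[of _ r]) auto
  qed
  then obtain r where r: "\<And>b. r b \<in> \<rat>" "\<And>b. \<bar>r b - b\<bar> < \<delta>" "r 1 = 1"
    by metis
  define \<phi> where "\<phi> = rat_real_pair.construct B r"
  have lin: "Vector_Spaces.linear (\<lambda>(q::rat) (x::real). of_rat q * x)
      (\<lambda>(q::rat) (x::real). of_rat q * x) \<phi>"
    unfolding \<phi>_def using B(1) by (rule rat_real_pair.linear_construct)
  interpret \<phi>: Vector_Spaces.linear "\<lambda>(q::rat) (x::real). of_rat q * x"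
    "\<lambda>(q::rat) (x::real). of_rat q * x" \<phi>
    by (rule lin)
  have on_basis: "\<phi> b = r b" if "b \<in> B" for b
    unfolding \<phi>_def using B that by (intro rat_real_pair.construct_basis)
  have in_B: "b \<in> B" if "c x b \<noteq> 0" for x b
    using that unfolding c_def by (rule rat_real.representation_ne_zero)
  have phi_expand: "\<phi> x = (\<Sum>b | c x b \<noteq> 0. of_rat (c x b) * r b)" for x
  proof -
    have "\<phi> x = \<phi> (\<Sum>b | c x b \<noteq> 0. of_rat (c x b) * b)"
      by (simp only: expand)
    also have "\<dots> = (\<Sum>b | c x b \<noteq> 0. of_rat (c x b) * \<phi> b)"
      by (simp only: \<phi>.sum \<phi>.scale)
    finally show ?thesis
      using in_B on_basis by (auto intro!: sum.cong)
  qed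
  have rational: "\<phi> x \<in> \<rat>" for x
    unfolding phi_expand using r by (intro Rats_sum Rats_mult) auto
  have close: "\<bar>\<phi> x - x\<bar> < \<epsilon>" if x: "x \<in> X" for x
  proof -
    have "\<phi> x - x = (\<Sum>b | c x b \<noteq> 0. of_rat (c x b) * (r b - b))"
      using phi_expand[of x] expand[of x] by (simp add: right_diff_distrib sum_subtractf)
    also have "\<bar>\<dots>\<bar> \<le> (\<Sum>b | c x b \<noteq> 0. \<bar>of_rat (c x b)\<bar> * \<delta>)"
      using r(2) by (intro order_trans[OF sum_abs] sum_mono)
        (auto simp: abs_mult intro!: mult_left_mono less_imp_le)
    also have "\<dots> = (\<Sum>b | c x b \<noteq> 0. \<bar>of_rat (c x b)\<bar>) * \<delta>"
      by (simp add: sum_distrib_right)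
    also have "\<dots> \<le> M * \<delta>"
      unfolding M_def using fin x delta
      by (intro mult_right_mono member_le_sum[of x X] sum_nonneg) auto
    also have "\<dots> < \<epsilon>"
      using eps M_nonneg by (simp add: \<delta>_def field_simps)
    finally show ?thesis .
  qed
  show thesis
    using that[of \<phi>] \<phi>.add \<phi>.scale on_basis[OF B(3)] r(3) rational close by auto
qed

text \<open>
  If \<open>\<epsilon>\<close> is smaller than every positive element of \<open>X\<close>, an \<open>\<epsilon>\<close>-approximation cannot change the
  sign of a positive element, and linearity takes care of \<open>0\<close>.
\<close>

lemma rational_linear_nonneg:
  fixes X :: "real set"
  assumes fin: "finite X"
  obtains \<phi> :: "real \<Rightarrow> real"
  where "Modules.additive \<phi>" "\<And>x. x \<in> \<rat> \<Longrightarrow> \<phi> x = x" "\<And>x. \<phi> x \<in> \<rat>"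
    "\<And>x. x \<in> X \<Longrightarrow> x \<ge> 0 \<Longrightarrow> \<phi> x \<ge> 0"
proof -
  define \<epsilon> where "\<epsilon> = Min (insert 1 {x \<in> X. x > 0})"
  have "\<epsilon> > 0" and eps_le: "\<And>x. x \<in> X \<Longrightarrow> x > 0 \<Longrightarrow> \<epsilon> \<le> x"
    using fin by (auto simp: \<epsilon>_def)
  from rational_linear_approximation[OF fin \<open>\<epsilon> > 0\<close>] obtain \<phi> where
    add: "\<And>x y. \<phi> (x + y) = \<phi> x + \<phi> y" and
    scale: "\<And>r x. \<phi> (of_rat r * x) = of_rat r * \<phi> x" and
    \<phi>: "\<phi> 1 = 1" "\<And>x. \<phi> x \<in> \<rat>" "\<And>x. x \<in> X \<Longrightarrow> \<bar>\<phi> x - x\<bar> < \<epsilon>"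
    by blast
  have "\<phi> x = x" if "x \<in> \<rat>" for x
    using that scale[of _ 1] \<phi>(1) by (auto elim!: Rats_cases)
  moreover have "\<phi> x \<ge> 0" if "x \<in> X" "x \<ge> 0" for x
  proof (cases "x = 0")
    case True
    then show ?thesis
      using scale[of 0 0] by simp
  next
    case False
    then show ?thesis
      using \<phi>(3)[OF that(1)] eps_le[OF that(1)] that(2) by linarith
  qed
  ultimately show thesis
    using that[of \<phi>] add \<phi>(2) by (auto simp: Modules.additive_def)
qed

section \<open>Rational points of the service rate region\<close>

lemma common_denominator:
  fixes X :: "real set"
  assumes "finite X" "X \<subseteq> \<rat>"
  obtains s :: nat where "s \<ge> 1" "\<And>x. x \<in> X \<Longrightarrow> real s * x \<in> \<int>"
proof -
  have "\<exists>s::nat. s \<ge> 1 \<and> (\<forall>x\<in>X. real s * x \<in> \<int>)"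
    using assms
  proof (induction X rule: finite_induct)
    case empty
    then show ?case by auto
  next
    case (insert y X)
    then obtain s :: nat where s: "s \<ge> 1" "\<And>x. x \<in> X \<Longrightarrow> real s * x \<in> \<int>"
      by auto
    obtain a :: int and b :: nat where b: "b > 0" "y = of_int a / of_nat b"
      using insert.prems unfolding Rats_eq_int_div_nat by force
    have "real (s * b) * x \<in> \<int>" if "x \<in> X" for x
      using Ints_mult[OF Ints_of_nat[of b] s(2)[OF that]] by (simp add: mult_ac)
    moreover have "real (s * b) * y = of_int (int s * a)"
      using b by simp
    then have "real (s * b) * y \<in> \<int>"
      by (metis Ints_of_int)
    ultimately show ?case
      using s(1) b(1) by (intro exI[of _ "s * b"]) auto
  qed
  then show thesis
    using that by blast
qed

lemma one_shot_regionI: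
  assumes "\<And>i. x $ i = (\<Sum>S\<in>\<R> i. real (\<alpha> i S)) / real s"
    and "\<And>\<nu>. (\<Sum>i\<in>UNIV. \<Sum>S\<in>{S \<in> \<R> i. \<nu> \<in> S}. real (\<alpha> i S)) \<le> real s"
  shows "x \<in> one_shot_region \<R> s"
proof -
  have "real (server_load \<R> \<alpha> \<nu>) \<le> real s" for \<nu>
    using assms(2)[of \<nu>] by (simp add: server_load_def)
  then show ?thesis
    unfolding one_shot_region_def
    using assms(1) by (auto intro!: exI[of _ \<alpha>] simp: vec_eq_iff service_rate_def)
qed

lemma rational_service_rate_region_subset:
  "rational_service_rate_region \<R> \<subseteq> service_rate_region \<R> \<inter> {x. \<forall>i. x $ i \<in> \<rat>}"
proof
  fix x
  assume "x \<in> rational_service_rate_region \<R>"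
  then obtain s \<alpha> where s: "s \<ge> 1"
    and x: "x = (\<chi> i. real (service_rate \<R> \<alpha> $ i) / real s)"
    and load: "\<And>\<nu>. server_load \<R> \<alpha> \<nu> \<le> s"
    by (auto simp: rational_service_rate_region_def one_shot_region_def)
  have "(\<Sum>i\<in>UNIV. \<Sum>S\<in>{S \<in> \<R> i. \<nu> \<in> S}. real (\<alpha> i S) / real s) \<le> 1" for \<nu>
  proof -
    have "(\<Sum>i\<in>UNIV. \<Sum>S\<in>{S \<in> \<R> i. \<nu> \<in> S}. real (\<alpha> i S) / real s)
        = real (server_load \<R> \<alpha> \<nu>) / real s"
      by (simp add: server_load_def sum_divide_distrib)
    then show ?thesis
      using load[of \<nu>] s by simp
  qed
  then have "x \<in> service_rate_region \<R>"
    unfolding service_rate_region_def x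
    by (auto intro!: exI[of _ "\<lambda>i S. real (\<alpha> i S) / real s"]
        simp: service_rate_def sum_divide_distrib)
  then show "x \<in> service_rate_region \<R> \<inter> {x. \<forall>i. x $ i \<in> \<rat>}"
    by (auto simp: x)
qed

text \<open>
  The map \<open>\<phi>\<close> has to keep nonnegative both the allocated amounts and the free capacities of the
  servers; it then turns a real allocation into a rational one, with unchanged rational rates.
\<close>

lemma rational_points_subset:
  "service_rate_region \<R> \<inter> {x. \<forall>i. x $ i \<in> \<rat>} \<subseteq> rational_service_rate_region \<R>"
proof
  fix x
  assume "x \<in> service_rate_region \<R> \<inter> {x. \<forall>i. x $ i \<in> \<rat>}"
  then obtain l where rat: "\<And>i. x $ i \<in> \<rat>"
    and l: "\<And>i S. S \<in> \<R> i \<Longrightarrow> l i S \<ge> 0" "\<And>i. (\<Sum>S\<in>\<R> i. l i S) = x $ i"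
    and load: "\<And>\<nu>. (\<Sum>i\<in>UNIV. \<Sum>S\<in>{S \<in> \<R> i. \<nu> \<in> S}. l i S) \<le> 1"
    by (auto simp: service_rate_region_def)
  define slack where "slack \<nu> = 1 - (\<Sum>i\<in>UNIV. \<Sum>S\<in>{S \<in> \<R> i. \<nu> \<in> S}. l i S)" for \<nu>
  define X where "X = range (\<lambda>(i, S). l i S) \<union> range slack"
  have "finite X"
    by (simp add: X_def)
  then obtain \<phi> where \<phi>: "Modules.additive \<phi>" "\<And>x. x \<in> \<rat> \<Longrightarrow> \<phi> x = x" "\<And>x. \<phi> x \<in> \<rat>"
    and nonneg: "\<And>x. x \<in> X \<Longrightarrow> x \<ge> 0 \<Longrightarrow> \<phi> x \<ge> 0"
    by (rule rational_linear_nonneg) blast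
  have l': "\<phi> (l i S) \<ge> 0" if "S \<in> \<R> i" for i S
    using nonneg l(1)[OF that] by (force simp: X_def)
  have rate': "(\<Sum>S\<in>\<R> i. \<phi> (l i S)) = x $ i" for i
    using Modules.additive.sum[OF \<phi>(1), of "l i" "\<R> i"] l(2) \<phi>(2)[OF rat[of i]] by simp
  have load': "(\<Sum>i\<in>UNIV. \<Sum>S\<in>{S \<in> \<R> i. \<nu> \<in> S}. \<phi> (l i S)) \<le> 1" for \<nu>
  proof -
    have "0 \<le> \<phi> (slack \<nu>)"
      using load[of \<nu>] by (intro nonneg) (auto simp: X_def slack_def)
    also have "\<phi> (slack \<nu>) = 1 - (\<Sum>i\<in>UNIV. \<Sum>S\<in>{S \<in> \<R> i. \<nu> \<in> S}. \<phi> (l i S))"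
      using \<phi>(2)[of 1] by (simp add: slack_def Modules.additive.diff[OF \<phi>(1)]
          Modules.additive.sum[OF \<phi>(1)])
    finally show ?thesis
      by simp
  qed
  obtain s :: nat where s: "s \<ge> 1"
    and "\<And>y. y \<in> range (\<lambda>(i, S). \<phi> (l i S)) \<Longrightarrow> real s * y \<in> \<int>"
    using common_denominator[of "range (\<lambda>(i, S). \<phi> (l i S))"] \<phi>(3) by (auto simp: split_beta)
  then have int: "real s * \<phi> (l i S) \<in> \<int>" for i S
    by force
  define \<alpha> where "\<alpha> i S = nat \<lfloor>real s * \<phi> (l i S)\<rfloor>" for i S
  have \<alpha>: "real (\<alpha> i S) = real s * \<phi> (l i S)" if "S \<in> \<R> i" for i S
    using int[of i S] l'[OF that] by (auto simp: \<alpha>_def elim!: Ints_cases)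
  have "x \<in> one_shot_region \<R> s"
  proof (rule one_shot_regionI)
    show "x $ i = (\<Sum>S\<in>\<R> i. real (\<alpha> i S)) / real s" for i
      using s rate'[of i] by (simp add: \<alpha> flip: sum_distrib_left)
    show "(\<Sum>i\<in>UNIV. \<Sum>S\<in>{S \<in> \<R> i. \<nu> \<in> S}. real (\<alpha> i S)) \<le> real s" for \<nu>
      using mult_left_mono[OF load'[of \<nu>], of "real s"] by (simp add: \<alpha> sum_distrib_left)
  qed
  then show "x \<in> rational_service_rate_region \<R>"
    using s by (auto simp: rational_service_rate_region_def)
qed

section \<open>Density and closedness\<close>

text \<open>
  Rounding \<open>m \<lambda>\<^sub>i\<^sub>,\<^sub>R\<close> down never increases a load, and after division by \<open>m\<close> each of the finitely
  many terms changes by less than \<open>1/m\<close>.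
\<close>

lemma service_rate_region_subset_closure:
  "service_rate_region \<R> \<subseteq> closure (rational_service_rate_region \<R>)"
proof
  fix x
  assume "x \<in> service_rate_region \<R>"
  then obtain l where l: "\<And>i S. S \<in> \<R> i \<Longrightarrow> l i S \<ge> 0" "\<And>i. (\<Sum>S\<in>\<R> i. l i S) = x $ i"
    and load: "\<And>\<nu>. (\<Sum>i\<in>UNIV. \<Sum>S\<in>{S \<in> \<R> i. \<nu> \<in> S}. l i S) \<le> 1"
    by (auto simp: service_rate_region_def)
  define \<alpha> where "\<alpha> m i S = nat \<lfloor>real (Suc m) * l i S\<rfloor>" for m i S
  have \<alpha>: "real (\<alpha> m i S) \<le> real (Suc m) * l i S" if "S \<in> \<R> i" for m i S
    using mult_nonneg_nonneg[OF of_nat_0_le_iff l(1)[OF that], of "Suc m"]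
    by (simp add: \<alpha>_def del: of_nat_Suc)
  define y where "y m = (\<chi> i. (\<Sum>S\<in>\<R> i. real (\<alpha> m i S)) / real (Suc m))" for m
  have "y m \<in> one_shot_region \<R> (Suc m)" for m
  proof (rule one_shot_regionI)
    show "y m $ i = (\<Sum>S\<in>\<R> i. real (\<alpha> m i S)) / real (Suc m)" for i
      by (simp add: y_def)
    fix \<nu>
    have "(\<Sum>i\<in>UNIV. \<Sum>S\<in>{S \<in> \<R> i. \<nu> \<in> S}. real (\<alpha> m i S))
        \<le> (\<Sum>i\<in>UNIV. \<Sum>S\<in>{S \<in> \<R> i. \<nu> \<in> S}. real (Suc m) * l i S)"
      using \<alpha> by (intro sum_mono) auto
    also have "\<dots> \<le> real (Suc m)"
      using mult_left_mono[OF load[of \<nu>], of "real (Suc m)"]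
      by (simp add: sum_distrib_left del: of_nat_Suc)
    finally show "(\<Sum>i\<in>UNIV. \<Sum>S\<in>{S \<in> \<R> i. \<nu> \<in> S}. real (\<alpha> m i S)) \<le> real (Suc m)" .
  qed
  then have "\<forall>m. y m \<in> rational_service_rate_region \<R>"
    by (force simp: rational_service_rate_region_def)
  moreover have "y \<longlonglongrightarrow> x"
  proof (rule vec_tendstoI)
    fix i
    have "(\<lambda>m. real (\<alpha> m i S) / real (Suc m)) \<longlonglongrightarrow> l i S" if S: "S \<in> \<R> i" for S
    proof (rule tendsto_sandwich)
      have "l i S - inverse (real (Suc m)) \<le> real (\<alpha> m i S) / real (Suc m)" for m
      proof -
        have "real (Suc m) * l i S - 1 \<le> real (\<alpha> m i S)"
          unfolding \<alpha>_def by linarith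
        from divide_right_mono[OF this, of "real (Suc m)"] show ?thesis
          by (simp add: diff_divide_distrib inverse_eq_divide del: of_nat_Suc)
      qed
      then show "\<forall>\<^sub>F m in sequentially.
          l i S - inverse (real (Suc m)) \<le> real (\<alpha> m i S) / real (Suc m)"
        by simp
      show "\<forall>\<^sub>F m in sequentially. real (\<alpha> m i S) / real (Suc m) \<le> l i S"
        using \<alpha>[OF S] by (intro always_eventually allI) (simp add: field_simps)
      show "(\<lambda>m. l i S - inverse (real (Suc m))) \<longlonglongrightarrow> l i S"
        using tendsto_diff[OF tendsto_const LIMSEQ_inverse_real_of_nat] by simp
    qed simp
    then have "(\<lambda>m. \<Sum>S\<in>\<R> i. real (\<alpha> m i S) / real (Suc m)) \<longlonglongrightarrow> (\<Sum>S\<in>\<R> i. l i S)"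
      by (rule tendsto_sum)
    then show "(\<lambda>m. y m $ i) \<longlonglongrightarrow> x $ i"
      by (simp add: y_def l(2) sum_divide_distrib)
  qed
  ultimately show "x \<in> closure (rational_service_rate_region \<R>)"
    unfolding closure_sequential by blast
qed

text \<open>
  An amount allocated to a nonempty set is a summand of the load of a server in that set, hence at
  most \<open>1\<close>. Coordinates outside \<open>\<R> i\<close> do not affect the rates, so they may be cut off to \<open>0\<close>, and the
  allocations in the unit cube with loads at most \<open>1\<close> suffice to produce the whole region.
\<close>

lemma compact_service_rate_region:
  fixes \<R> :: "'k::finite \<Rightarrow> 'n::finite set set"
  assumes nonempty: "\<And>i. {} \<notin> \<R> i"
  shows "compact (service_rate_region \<R>)"
proof -
  define load where
    "load v \<nu> = (\<Sum>i\<in>UNIV. \<Sum>S\<in>{S \<in> \<R> i. \<nu> \<in> S}. v $ (i, S))"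
    for v :: "real ^ ('k \<times> 'n set)" and \<nu>
  define rate :: "real ^ ('k \<times> 'n set) \<Rightarrow> real ^ 'k" where
    "rate v = (\<chi> i. \<Sum>S\<in>\<R> i. v $ (i, S))" for v
  define K where "K = cbox 0 1 \<inter> {v. \<forall>\<nu>. load v \<nu> \<le> 1}"
  have "closed {v. \<forall>\<nu>. load v \<nu> \<le> 1}"
    unfolding load_def by (intro closed_Collect_all closed_Collect_le continuous_intros)
  then have "compact K"
    unfolding K_def by (intro compact_Int_closed compact_cbox)
  moreover have "continuous_on K rate"
    unfolding rate_def by (intro continuous_intros)
  ultimately have "compact (rate ` K)"
    by (rule compact_continuous_image[rotated])
  moreover have "rate ` K = service_rate_region \<R>"
  proof
    show "rate ` K \<subseteq> service_rate_region \<R>"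
    proof
      fix x assume "x \<in> rate ` K"
      then obtain v where "v \<in> K" "x = rate v"
        by blast
      then show "x \<in> service_rate_region \<R>"
        unfolding service_rate_region_def
        by (auto intro!: exI[of _ "\<lambda>i S. v $ (i, S)"]
            simp: K_def load_def rate_def mem_box_cart)
    qed
    show "service_rate_region \<R> \<subseteq> rate ` K"
    proof
      fix x assume "x \<in> service_rate_region \<R>"
      then obtain l where l: "\<And>i S. S \<in> \<R> i \<Longrightarrow> l i S \<ge> 0" "\<And>i. (\<Sum>S\<in>\<R> i. l i S) = x $ i"
        and load1: "\<And>\<nu>. (\<Sum>i\<in>UNIV. \<Sum>S\<in>{S \<in> \<R> i. \<nu> \<in> S}. l i S) \<le> 1"
        by (auto simp: service_rate_region_def)
      define v :: "real ^ ('k \<times> 'n set)" where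
        "v = (\<chi> p. if snd p \<in> \<R> (fst p) then l (fst p) (snd p) else 0)"
      have le1: "l i S \<le> 1" if S: "S \<in> \<R> i" for i S
      proof -
        obtain \<nu> where \<nu>: "\<nu> \<in> S"
          using S nonempty by (metis ex_in_conv)
        have "l i S \<le> (\<Sum>S\<in>{S \<in> \<R> i. \<nu> \<in> S}. l i S)"
          using S \<nu> l(1) by (intro member_le_sum) auto
        also have "\<dots> \<le> (\<Sum>i\<in>UNIV. \<Sum>S\<in>{S \<in> \<R> i. \<nu> \<in> S}. l i S)"
          using l(1) by (intro member_le_sum[of i UNIV "\<lambda>i. \<Sum>S\<in>{S \<in> \<R> i. \<nu> \<in> S}. l i S"]
              sum_nonneg) auto
        also have "\<dots> \<le> 1"
          by (rule load1)
        finally show ?thesis .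
      qed
      have "rate v = x"
        by (simp add: rate_def v_def vec_eq_iff flip: l(2))
      moreover have "load v \<nu> \<le> 1" for \<nu>
        using load1[of \<nu>] by (simp add: load_def v_def)
      moreover have "v \<in> cbox 0 1"
        using l(1) le1 by (auto simp: mem_box_cart v_def)
      ultimately show "x \<in> rate ` K"
        by (auto simp: K_def)
    qed
  qed
  ultimately show ?thesis
    by simp
qed

lemma G_system_nonempty:
  assumes "G_system G \<R>"
  shows "{} \<notin> \<R> i"
proof
  assume "{} \<in> \<R> i"
  with assms have "{} \<in> recovery_sets_all G i"
    unfolding G_system_def by blast
  then show False
    by (simp add: recovery_sets_all_def axis_eq_0_iff)
qed

theorem theorem3p3:
  fixes q :: nat
    and G :: "'f::{field,finite} ^ 'n::finite ^ 'k::finite"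
    and \<R> :: "'k \<Rightarrow> 'n set set"
  assumes "primepow q" and "CARD('f) = q"
    and "CARD('k) \<ge> 2" and "CARD('n) > CARD('k)"
    and "rank G = CARD('k)"
    and "\<forall>\<nu>. column \<nu> G \<noteq> 0"
    and "G_system G \<R>"
  shows "rational_service_rate_region \<R> = service_rate_region \<R> \<inter> {x. \<forall>i. x $ i \<in> \<rat>} \<and>
    service_rate_region \<R> = closure (rational_service_rate_region \<R>)"
proof
  show "rational_service_rate_region \<R> = service_rate_region \<R> \<inter> {x. \<forall>i. x $ i \<in> \<rat>}"
    using rational_service_rate_region_subset rational_points_subset by (rule equalityI)
  have "closed (service_rate_region \<R>)"
    using G_system_nonempty[OF assms(7)]
    by (intro compact_imp_closed compact_service_rate_region)
  then have "closure (rational_service_rate_region \<R>) \<subseteq> service_rate_region \<R>"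
    using rational_service_rate_region_subset[of \<R>] by (intro closure_minimal) auto
  with service_rate_region_subset_closure
  show "service_rate_region \<R> = closure (rational_service_rate_region \<R>)"
    by (rule equalityI)
qed

end
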